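(* Let $\mathbb{B}$ be a complete Boolean algebra. Then: (a) $\operatorname{cl}_{\omega_1}(\{b\})=b\uparrow$ for each $b\in\mathbb{B}$; (b) if $A\subset\mathbb{B}$ and $|A|<\aleph_0$, then $\operatorname{cl}_{\omega_1}(A)=\bigcup_{a\in A}a\uparrow=A\uparrow$.
   Context: For a sequence $x=\langle x_n:n\in\omega\rangle$ in $\mathbb{B}$, $\limsup x=\bigwedge_{k\in\omega}\bigvee_{n\ge k}x_n$. For $A\subset\mathbb{B}$, $A\uparrow=\{b\in\mathbb{B}:\exists a\in A\ a\le b\}$ and $b\uparrow=\{b\}\uparrow$. Let $u(A)=\bigcup_{y\in A^\omega}(\limsup y)\uparrow$, and define by recursion $\operatorname{cl}_0(A)=A$, $\operatorname{cl}_{\alpha+1}(A)=u(\operatorname{cl}_\alpha(A))$, and $\operatorname{cl}_\gamma(A)=\bigcup_{\alpha<\gamma}\operatorname{cl}_\alpha(A)$ for limit $\gamma\le\omega_1$. The operator $\operatorname{cl}_{\omega_1}$ is the closure operator of the topology $\mathcal{O}^\uparrow$ on $\mathbb{B}$ generated by the convergence $x\mapsto\{\limsup x\}$ ($O$ is open iff for every sequence $x$ in $\mathbb{B}$ with $\limsup x\in O$, $x_n\in O$ for all but finitely many $n$). *)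

theory Defs
  imports Complex_Main "HOL-Library.Liminf_Limsup"
begin

text \<open>A complete Boolean algebra is a type of sort \<open>{boolean_algebra, complete_lattice}\<close>.
  The library class \<open>complete_boolean_algebra\<close> would be too narrow: it extends
  \<open>complete_distrib_lattice\<close>, whose axiom is complete distributivity, so that it
  contains only the atomic complete Boolean algebras.\<close>

definition upset :: "'a::order set \<Rightarrow> 'a set" where
  "upset A = {b. \<exists>a\<in>A. a \<le> b}"

text \<open>By \<open>limsup_INF_SUP\<close>, \<open>limsup y = (INF k. SUP n\<in>{k..}. y n)\<close>.\<close>

definition u_op :: "'a::complete_lattice set \<Rightarrow> 'a set" where
  "u_op A = (\<Union>y\<in>{y :: nat \<Rightarrow> 'a. range y \<subseteq> A}. upset {limsup y})"

text \<open>Elements of the field of a well-order \<open>r\<close> stand for the ordinals below the order type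
  of \<open>r\<close>.  Then \<open>i\<close> is \<open>0\<close> iff it has no strict predecessors, and, if it is not \<open>0\<close>, it is
  the successor of \<open>j\<close> iff \<open>{k. k < i} = {k. k \<le> j}\<close>.\<close>

definition cl_step :: "'i rel \<Rightarrow> 'a::complete_lattice set \<Rightarrow> ('i \<Rightarrow> 'a set) \<Rightarrow> 'i \<Rightarrow> 'a set" where
  "cl_step r A f i =
     (if underS r i = {} then A
      else if \<exists>j. underS r i = under r j then u_op (f (THE j. underS r i = under r j))
      else (\<Union>k\<in>underS r i. f k))"

definition cl_at :: "'i rel \<Rightarrow> 'a::complete_lattice set \<Rightarrow> 'i \<Rightarrow> 'a set" where
  "cl_at r A = wo_rel.worec r (cl_step r A)"

lemma under_inj:
  assumes "Well_order r" "under r j = under r k" "under r j \<noteq> {}"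
  shows "j = k"
proof -
  have W: "wo_rel r" using assms(1) by (simp add: wo_rel_def)
  have "j \<in> Field r" "k \<in> Field r"
    using assms(2,3) by (auto simp: under_def Field_def)
  then have "j \<in> under r j" "k \<in> under r k"
    using wo_rel.REFL[OF W] by (auto simp: under_def refl_on_def)
  then show ?thesis
    using assms(2) wo_rel.ANTISYM[OF W] by (auto simp: under_def antisym_def)
qed

lemma the_pred:
  assumes "Well_order r" "underS r i = under r j" "underS r i \<noteq> {}"
  shows "(THE j. underS r i = under r j) = j"
proof (rule the_equality)
  fix k assume "underS r i = under r k"
  then show "k = j" using under_inj[OF assms(1), of k j] assms(2,3) by simp
qed (rule assms(2))

lemma cl_at_unfold:
  assumes "Well_order r"
  shows "cl_at r A i = cl_step r A (cl_at r A) i"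
proof -
  have W: "wo_rel r" using assms by (simp add: wo_rel_def)
  have "cl_step r A f x = cl_step r A g x" if eq: "\<forall>y\<in>underS r x. f y = g y" for f g x
  proof (cases "underS r x \<noteq> {} \<and> (\<exists>j. underS r x = under r j)")
    case True
    then obtain j where j: "underS r x = under r j" by blast
    then have "j \<in> Field r" using True by (auto simp: under_def Field_def)
    then have "j \<in> underS r x" unfolding j using wo_rel.REFL[OF W] by (auto simp: under_def refl_on_def)
    moreover have "(THE j. underS r x = under r j) = j"
      using the_pred[OF assms j] True by blast
    ultimately show ?thesis using eq True by (simp add: cl_step_def)
  next
    case False
    then show ?thesis using eq by (auto simp: cl_step_def)
  qed
  then have "wo_rel.adm_wo r (cl_step r A)" unfolding wo_rel.adm_wo_def[OF W] by blast
  from wo_rel.worec_fixpoint[OF W this] show ?thesis unfolding cl_at_def by metis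
qed

lemma cl_at_zero: "Well_order r \<Longrightarrow> underS r i = {} \<Longrightarrow> cl_at r A i = A"
  by (subst cl_at_unfold) (auto simp: cl_step_def)

lemma cl_at_succ:
  assumes "Well_order r" "j \<in> Field r" "underS r i = under r j"
  shows "cl_at r A i = u_op (cl_at r A j)"
proof -
  have "j \<in> under r j"
    using assms(1,2) by (auto simp: under_def well_order_on_def linear_order_on_def
        partial_order_on_def preorder_on_def refl_on_def)
  then have ne: "underS r i \<noteq> {}" using assms(3) by auto
  have "\<exists>j. underS r i = under r j" using assms(3) by blast
  with ne show ?thesis
    by (simp only: cl_at_unfold[OF assms(1), of A i] cl_step_def if_False if_True
        the_pred[OF assms(1,3) ne])
qed

lemma cl_at_limit:
  "Well_order r \<Longrightarrow> underS r i \<noteq> {} \<Longrightarrow> \<nexists>j. underS r i = under r j \<Longrightarrow>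
    cl_at r A i = (\<Union>k\<in>underS r i. cl_at r A k)"
  by (subst cl_at_unfold) (auto simp: cl_step_def)

text \<open>\<open>cardSuc natLeq\<close> is a well-order of type \<open>\<omega>\<^sub>1\<close>; the following is the limit
  clause of the recursion at \<open>\<omega>\<^sub>1\<close> itself.\<close>

definition cl_omega1 :: "'a::complete_lattice set \<Rightarrow> 'a set" where
  "cl_omega1 A = (\<Union>i\<in>Field (cardSuc natLeq). cl_at (cardSuc natLeq) A i)"

end

(* For finite A, a sequence in the upward closure of A lies above one fixed a in A infinitely
   often, so its limsup is above a.  Hence the upward closure of A is closed under u, and
   cl_omega1 A is contained in it.  Conversely, constant sequences show that cl_1(A) already
   contains it. *)

theory Submission
  imports Defs
begin

lemma upset_eq_UN: "upset A = (\<Union>a\<in>A. upset {a})"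
  by (auto simp: upset_def)

lemma subset_upset: "A \<subseteq> upset A"
  by (auto simp: upset_def)

lemma u_op_mono: "A \<subseteq> B \<Longrightarrow> u_op A \<subseteq> u_op B"
  unfolding u_op_def by blast

text \<open>The constant sequence at a member \<open>a\<close> of \<open>A\<close> has limsup
  \<open>a\<close>, so one application of \<open>u_op\<close> reaches everything above
  \<open>a\<close>.\<close>

lemma upset_subset_u_op: "upset A \<subseteq> u_op (A :: 'a::complete_lattice set)"
proof
  fix b assume "b \<in> upset A"
  then obtain a where a: "a \<in> A" "a \<le> b" by (auto simp: upset_def)
  have "limsup (\<lambda>n::nat. a) = a" by (simp add: Limsup_const)
  with a have "range (\<lambda>n::nat. a) \<subseteq> A" "b \<in> upset {limsup (\<lambda>n::nat. a)}"
    by (auto simp: upset_def)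
  then show "b \<in> u_op A" unfolding u_op_def by blast
qed

text \<open>An infinite set of indices meets every tail, so each tail supremum lies above
  \<open>a\<close>, and hence so does their infimum.\<close>

lemma le_limsup_if_infinite:
  fixes y :: "nat \<Rightarrow> 'a::complete_lattice"
  assumes "infinite {n. a \<le> y n}"
  shows "a \<le> limsup y"
  unfolding limsup_INF_SUP
proof (rule INF_greatest)
  fix k :: nat
  obtain n where "n \<ge> k" "a \<le> y n"
    using assms unfolding finite_nat_set_iff_bounded by (auto simp: not_less)
  then show "a \<le> (SUP n\<in>{k..}. y n)" by (auto intro: SUP_upper2)
qed

lemma u_op_upset_finite:
  fixes A :: "'a::complete_lattice set"
  assumes "finite A"
  shows "u_op (upset A) \<subseteq> upset A"
proof
  fix b assume "b \<in> u_op (upset A)"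
  then obtain y :: "nat \<Rightarrow> 'a" where y: "range y \<subseteq> upset A" and b: "limsup y \<le> b"
    by (auto simp: u_op_def upset_def)
  have "\<forall>n. \<exists>a\<in>A. a \<le> y n" using y by (auto simp: upset_def)
  \<comment> \<open>\<open>f\<close> colours each index by a member of \<open>A\<close> below the
    corresponding term. As there are finitely many colours, some colour \<open>f m\<close> recurs
    infinitely often.\<close>
  then obtain f where f: "\<And>n. f n \<in> A" "\<And>n. f n \<le> y n" by metis
  have "finite (range f)" using f(1) assms by (auto intro: finite_subset)
  then obtain m where "infinite {n. f n = f m}"
    using pigeonhole_infinite[of UNIV f] by auto
  moreover have "{n. f n = f m} \<subseteq> {n. f m \<le> y n}" using f(2) by (auto dest: sym)
  ultimately have "infinite {n. f m \<le> y n}" by (meson finite_subset)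
  then have "f m \<le> limsup y" by (rule le_limsup_if_infinite)
  with b f(1) show "b \<in> upset A" by (auto simp: upset_def intro: order_trans)
qed

text \<open>Each of the three clauses of the recursion preserves inclusion in a set closed under
  \<open>u_op\<close>. An index outside the field has no strict predecessors and falls under the
  zero clause.\<close>

lemma cl_at_subset:
  assumes W: "Well_order r" and "A \<subseteq> U" and U: "u_op U \<subseteq> U"
  shows "cl_at r A i \<subseteq> U"
proof -
  have wo: "wo_rel r" using W by (simp add: wo_rel_def)
  show ?thesis
  proof (induction i rule: wo_rel.well_order_induct[OF wo])
    case (1 i)
    then have IH: "cl_at r A k \<subseteq> U" if "k \<in> underS r i" for k
      using that by (auto simp: underS_def)
    consider (zero) "underS r i = {}"
      | (succ) j where "underS r i \<noteq> {}" "underS r i = under r j"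
      | (limit) "underS r i \<noteq> {}" "\<nexists>j. underS r i = under r j"
      by blast
    then show ?case
    proof cases
      case zero
      then show ?thesis using cl_at_zero[OF W] assms(2) by metis
    next
      case succ
      \<comment> \<open>Since \<open>under r j\<close> is nonempty, \<open>j\<close> is in the
        field. Reflexivity then puts \<open>j\<close> in \<open>under r j\<close>, that is, among
        the strict predecessors of \<open>i\<close>, where the induction hypothesis applies.\<close>
      then have j: "j \<in> Field r" by (auto simp: under_def Field_def)
      then have "j \<in> underS r i"
        unfolding succ(2) using wo_rel.REFL[OF wo] by (auto simp: under_def refl_on_def)
      then have "u_op (cl_at r A j) \<subseteq> U" using IH u_op_mono U by (metis order_trans)
      then show ?thesis by (simp add: cl_at_succ[OF W j succ(2)])
    next
      case limit
      then show ?thesis using IH by (auto simp: cl_at_limit[OF W limit])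
    qed
  qed
qed

text \<open>Locates the ordinals 0 and 1 in \<open>r\<close>, as \<open>z\<close> and
  \<open>i\<close>, so that the first stage of the recursion can be computed.\<close>

lemma Well_order_zero_one:
  assumes W: "Well_order r" and "infinite (Field r)"
  obtains z i where "z \<in> Field r" "i \<in> Field r" "underS r z = {}" "underS r i = under r z"
proof -
  have wo: "wo_rel r" using W by (simp add: wo_rel_def)
  have least: "\<exists>m\<in>B. \<forall>b\<in>B. (m, b) \<in> r" if "B \<subseteq> Field r" "B \<noteq> {}" for B
    using wo_rel.minim_in[OF wo that] wo_rel.minim_least[OF wo that(1)] by blast
  have "Field r \<noteq> {}" using assms(2) by auto
  then obtain z where z: "z \<in> Field r" "\<forall>b\<in>Field r. (z, b) \<in> r"
    using least[of "Field r"] by blast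
  \<comment> \<open>The least element of what remains after removing \<open>z\<close> is the
    successor of \<open>z\<close>.\<close>
  have "Field r - {z} \<noteq> {}"
    using assms(2) by (metis finite.emptyI infinite_remove)
  then obtain i where i: "i \<in> Field r" "i \<noteq> z" "\<forall>b\<in>Field r - {z}. (i, b) \<in> r"
    using least[of "Field r - {z}"] by blast
  have anti: "x = y" if "(x, y) \<in> r" "(y, x) \<in> r" for x y
    using wo_rel.ANTISYM[OF wo] that by (auto simp: antisym_def)
  have "underS r z = {}"
    using z anti by (auto simp: underS_def Field_def)
  moreover have "under r z = {z}"
    using z anti by (auto simp: under_def Field_def)
  moreover have "underS r i = {z}"
    using z i anti by (auto simp: underS_def Field_def)
  ultimately show ?thesis using that z(1) i(1) by metis
qed

lemma cl_omega1_finite: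
  fixes A :: "'a::complete_lattice set"
  assumes "finite A"
  shows "cl_omega1 A = upset A"
proof
  let ?r = "cardSuc natLeq"
  have W: "Well_order ?r"
    using cardSuc_Card_order[OF natLeq_Card_order] by (rule card_order_on_well_order_on)
  have "infinite (Field ?r)"
    using cardSuc_finite[OF natLeq_Card_order] by (simp add: Field_natLeq)
  then obtain z i where zi: "z \<in> Field ?r" "i \<in> Field ?r" "underS ?r z = {}"
      "underS ?r i = under ?r z"
    by (rule Well_order_zero_one[OF W])
  \<comment> \<open>Stage 1 already contains all of \<open>upset A\<close>.\<close>
  have "cl_at ?r A i = u_op A"
    by (simp add: cl_at_succ[OF W zi(1,4)] cl_at_zero[OF W zi(3)])
  then show "upset A \<subseteq> cl_omega1 A"
    using upset_subset_u_op zi(2) unfolding cl_omega1_def by blast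
  \<comment> \<open>The closed set that bounds every stage is \<open>upset A\<close> itself; its
    closure under \<open>u_op\<close> is where finiteness of \<open>A\<close> enters.\<close>
  show "cl_omega1 A \<subseteq> upset A"
    unfolding cl_omega1_def
    using cl_at_subset[OF W subset_upset u_op_upset_finite[OF assms]] by blast
qed

theorem lemma4p6:
  shows "(\<forall>b::'a::{boolean_algebra, complete_lattice}. cl_omega1 {b} = upset {b}) \<and>
    (\<forall>A::'a set. finite A \<longrightarrow>
       cl_omega1 A = (\<Union>a\<in>A. upset {a}) \<and> (\<Union>a\<in>A. upset {a}) = upset A)"
  \<comment> \<open>The first part is the finite case for the singleton \<open>{b}\<close>.\<close>
  using cl_omega1_finite upset_eq_UN by blast

end
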